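(* Let $k,l$ be positive integers and $m\ge 0$ an integer. Let $N$ be a loopless and coloopless matroid of rank $k+m$ on a ground set of cardinality $k+l+m$. Then the matroid $\tau^m(N\oplus U_{k+m,k+l+m})$ (where $U_{k+m,k+l+m}$ is on a ground set disjoint from that of $N$) is a loopless and coloopless excluded minor for the class of almost $(k,l)$-uniform matroids.
   Context: For a matroid $M$ of positive rank, its truncation $\tau(M)$ is the matroid on the same ground set whose independent sets are the independent sets of $M$ that are not bases of $M$; $\tau^m$ denotes $m$-fold iterated truncation ($\tau^0$ is the identity). $U_{r,n}$ denotes the uniform matroid of rank $r$ on $n$ elements. A matroid is $(k,l)$-uniform if it has no minor isomorphic to $U_{k,k}\oplus U_{0,l}$. A matroid $M$ is almost $(k,l)$-uniform if for every element $v$, at least one of $M-v$ or $M/v$ is $(k,l)$-uniform. An excluded minor for a class is a matroid not in the class all of whose proper minors are in the class. *)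

theory Defs
  imports Main
begin

record 'a indep_system =
  ground :: "'a set"
  indeps :: "'a set set"

locale matroid =
  fixes M :: "'a indep_system"
  assumes finite_ground: "finite (ground M)"
    and indeps_subset: "indeps M \<subseteq> Pow (ground M)"
    and empty_indep: "{} \<in> indeps M"
    and indep_mono: "X \<in> indeps M \<Longrightarrow> Y \<subseteq> X \<Longrightarrow> Y \<in> indeps M"
    and augment: "X \<in> indeps M \<Longrightarrow> Y \<in> indeps M \<Longrightarrow> card X < card Y \<Longrightarrow>
      \<exists>y\<in>Y - X. insert y X \<in> indeps M"

definition bases :: "'a indep_system \<Rightarrow> 'a set set" where
  "bases M = {B \<in> indeps M. \<forall>X\<in>indeps M. B \<subseteq> X \<longrightarrow> X = B}"

definition rank :: "'a indep_system \<Rightarrow> nat" where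
  "rank M = Max (card ` indeps M)"

definition loopless :: "'a indep_system \<Rightarrow> bool" where
  "loopless M \<longleftrightarrow> \<not> (\<exists>v\<in>ground M. {v} \<notin> indeps M)"

definition coloopless :: "'a indep_system \<Rightarrow> bool" where
  "coloopless M \<longleftrightarrow> \<not> (\<exists>v\<in>ground M. \<forall>B\<in>bases M. v \<in> B)"

text \<open>Meant for matroids of positive rank only: in rank 0 the empty set is a basis, and its
  removal leaves no independent set at all.\<close>

definition truncation :: "'a indep_system \<Rightarrow> 'a indep_system" where
  "truncation M = \<lparr>ground = ground M, indeps = indeps M - bases M\<rparr>"

text \<open>The uniform matroid of rank \<open>r\<close> with ground set \<open>E\<close>; it is a copy of $U_{r,n}$ if \<open>E\<close> is a
  finite set with \<open>card E = n\<close> and \<open>r \<le> n\<close>.\<close>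

definition uniform_matroid :: "nat \<Rightarrow> 'a set \<Rightarrow> 'a indep_system" where
  "uniform_matroid r E = \<lparr>ground = E, indeps = {X. X \<subseteq> E \<and> card X \<le> r}\<rparr>"

text \<open>Meant for disjoint ground sets.\<close>

definition direct_sum :: "'a indep_system \<Rightarrow> 'a indep_system \<Rightarrow> 'a indep_system" where
  "direct_sum M N =
     \<lparr>ground = ground M \<union> ground N, indeps = {X \<union> Y |X Y. X \<in> indeps M \<and> Y \<in> indeps N}\<rparr>"

definition delete :: "'a indep_system \<Rightarrow> 'a set \<Rightarrow> 'a indep_system" where
  "delete M D = \<lparr>ground = ground M - D, indeps = {X \<in> indeps M. X \<subseteq> ground M - D}\<rparr>"

definition restriction :: "'a indep_system \<Rightarrow> 'a set \<Rightarrow> 'a indep_system" where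
  "restriction M A = delete M (ground M - A)"

text \<open>A set is independent in the contraction by \<open>C\<close> iff its union with a basis \<open>B\<close> of the
  restriction to \<open>C\<close> is independent; in a matroid this does not depend on the choice of \<open>B\<close>.
  If \<open>v\<close> is a loop, then the only such basis for \<open>C = {v}\<close> is empty, so that contracting a loop
  amounts to deleting it.\<close>

definition contract :: "'a indep_system \<Rightarrow> 'a set \<Rightarrow> 'a indep_system" where
  "contract M C =
     \<lparr>ground = ground M - C,
      indeps = {X. X \<subseteq> ground M - C \<and> (\<exists>B\<in>bases (restriction M C). X \<union> B \<in> indeps M)}\<rparr>"

definition is_minor :: "'a indep_system \<Rightarrow> 'a indep_system \<Rightarrow> bool" where
  "is_minor M' M \<longleftrightarrow> (\<exists>C D. C \<subseteq> ground M \<and> D \<subseteq> ground M \<and> C \<inter> D = {} \<and>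
     M' = delete (contract M C) D)"

definition isomorphic :: "'a indep_system \<Rightarrow> 'b indep_system \<Rightarrow> bool" where
  "isomorphic M N \<longleftrightarrow> (\<exists>f. bij_betw f (ground M) (ground N) \<and>
     (\<forall>X. X \<subseteq> ground M \<longrightarrow> (X \<in> indeps M \<longleftrightarrow> f ` X \<in> indeps N)))"

definition kl_uniform :: "nat \<Rightarrow> nat \<Rightarrow> 'a indep_system \<Rightarrow> bool" where
  "kl_uniform k l M \<longleftrightarrow> \<not> (\<exists>M'. is_minor M' M \<and>
     isomorphic M' (direct_sum (uniform_matroid k {..<k}) (uniform_matroid 0 {k..<k + l})))"

definition almost_kl_uniform :: "nat \<Rightarrow> nat \<Rightarrow> 'a indep_system \<Rightarrow> bool" where
  "almost_kl_uniform k l M \<longleftrightarrow>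
     (\<forall>v\<in>ground M. kl_uniform k l (delete M {v}) \<or> kl_uniform k l (contract M {v}))"

text \<open>A class of matroids is given by a predicate, of which only the values at matroids matter.\<close>

definition excluded_minor :: "('a indep_system \<Rightarrow> bool) \<Rightarrow> 'a indep_system \<Rightarrow> bool" where
  "excluded_minor P M \<longleftrightarrow>
     matroid M \<and> \<not> P M \<and> (\<forall>M'. is_minor M' M \<and> M' \<noteq> M \<longrightarrow> P M')"

end

theory Submission
  imports Defs
begin

text \<open>Call a set \<open>S\<close> of elements \<open>(k, l)\<close>-bad if its corank is at least \<open>k\<close> and its nullity at
  least \<open>l\<close>. A matroid is \<open>(k, l)\<close>-uniform iff it has no bad set, and a bad set of \<open>M / C - D\<close>
  becomes, after adding \<open>C\<close>, a bad set of \<open>M\<close> that contains \<open>C\<close> and avoids \<open>D\<close>. The bad sets of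
  the truncated sum are exactly the two summands \<open>E = ground N\<close> and \<open>F\<close>. For \<open>v \<in> F\<close>, the
  deletion of \<open>v\<close> keeps the bad set \<open>E\<close> and the contraction of \<open>v\<close> leaves the bad set
  \<open>F - {v}\<close>. Conversely, if both \<open>M' - u\<close> and \<open>M' / u\<close> have bad sets, where
  \<open>M'\<close> is obtained by contracting \<open>C\<close> and deleting \<open>D\<close>, then these come from two different bad
  sets that contain \<open>C\<close> and avoid \<open>D\<close>; as \<open>E\<close> and \<open>F\<close> are complementary, \<open>C\<close> and \<open>D\<close> are empty.\<close>

section \<open>Rank functions\<close>

definition rk :: "'a indep_system \<Rightarrow> 'a set \<Rightarrow> nat" where
  "rk M S = Max (card ` {X \<in> indeps M. X \<subseteq> S})"

context matroid
begin

lemma finite_indeps: "finite (indeps M)"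
  using finite_ground indeps_subset by (meson finite_Pow_iff finite_subset)

lemma indep_subset_ground: "X \<in> indeps M \<Longrightarrow> X \<subseteq> ground M"
  using indeps_subset by auto

lemma finite_indep: "X \<in> indeps M \<Longrightarrow> finite X"
  using indep_subset_ground finite_ground finite_subset by blast

lemma card_le_rk: "X \<in> indeps M \<Longrightarrow> X \<subseteq> S \<Longrightarrow> card X \<le> rk M S"
  unfolding rk_def using finite_indeps by (intro Max_ge) auto

lemma obtain_rk:
  obtains B where "B \<in> indeps M" "B \<subseteq> S" "card B = rk M S"
proof -
  have "rk M S \<in> card ` {X \<in> indeps M. X \<subseteq> S}"
    unfolding rk_def using finite_indeps empty_indep by (intro Max_in) auto
  then show ?thesis using that by auto
qed

lemma rk_eqI:
  assumes "\<And>X. X \<in> indeps M \<Longrightarrow> X \<subseteq> S \<Longrightarrow> card X \<le> n"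
    and "B \<in> indeps M" "B \<subseteq> S" "card B = n"
  shows "rk M S = n"
proof (rule antisym)
  obtain X where "X \<in> indeps M" "X \<subseteq> S" "card X = rk M S"
    using obtain_rk by metis
  then show "rk M S \<le> n" using assms(1) by metis
  show "n \<le> rk M S" using card_le_rk assms(2-4) by blast
qed

lemma rk_mono: "S \<subseteq> S' \<Longrightarrow> rk M S \<le> rk M S'"
  by (metis card_le_rk obtain_rk subset_trans)

lemma rk_le_card: "finite S \<Longrightarrow> rk M S \<le> card S"
  by (metis card_mono obtain_rk)

lemma rk_indep: "X \<in> indeps M \<Longrightarrow> rk M X = card X"
  by (meson card_le_rk finite_indep order_antisym rk_le_card subset_refl)

lemma rank_eq_rk: "rank M = rk M (ground M)"
proof -
  have "{X \<in> indeps M. X \<subseteq> ground M} = indeps M"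
    using indep_subset_ground by auto
  then show ?thesis by (simp add: rank_def rk_def)
qed

text \<open>Augmentation is repeated until the cardinality of \<open>Y\<close> is reached; the
  induction is on the number of elements still missing.\<close>

lemma extend_indep:
  assumes "X \<in> indeps M" "Y \<in> indeps M" "card X \<le> card Y"
  obtains Z where "X \<subseteq> Z" "Z \<subseteq> X \<union> Y" "Z \<in> indeps M" "card Z = card Y"
proof -
  have "\<exists>Z. X \<subseteq> Z \<and> Z \<subseteq> X \<union> Y \<and> Z \<in> indeps M \<and> card Z = card Y"
    using assms
  proof (induction "card Y - card X" arbitrary: X)
    case 0
    then show ?case by auto
  next
    case (Suc n)
    then have "card X < card Y" by simp
    then obtain y where y: "y \<in> Y - X" "insert y X \<in> indeps M"
      using augment[of X Y] Suc.prems by blast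
    have "card (insert y X) = Suc (card X)"
      using y Suc.prems finite_indep by auto
    then have "\<exists>Z. insert y X \<subseteq> Z \<and> Z \<subseteq> insert y X \<union> Y \<and> Z \<in> indeps M \<and> card Z = card Y"
      using Suc.hyps(2) Suc.prems y by (intro Suc.hyps(1)) auto
    then show ?case using y by auto
  qed
  then show ?thesis using that by blast
qed

text \<open>A largest independent subset of \<open>S\<close> is also maximal under inclusion, since
  one more element of \<open>S\<close> would exceed \<open>rk M S\<close>.\<close>

lemma insert_not_indep:
  assumes "B \<in> indeps M" "B \<subseteq> S" "card B = rk M S" "x \<in> S - B"
  shows "insert x B \<notin> indeps M"
proof
  assume "insert x B \<in> indeps M"
  then have "card (insert x B) \<le> rk M S"
    using assms by (intro card_le_rk) auto
  then show False using assms finite_indep by auto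
qed

text \<open>The nullity \<open>card S - rk M S\<close> grows with \<open>S\<close>: a largest
  independent subset of \<open>S'\<close> has at most \<open>rk M S\<close> elements in
  \<open>S\<close> and at most \<open>card S' - card S\<close> outside. The form with sums avoids
  subtraction on naturals.\<close>

lemma nullity_mono:
  assumes "S \<subseteq> S'" "S' \<subseteq> ground M"
  shows "card S + rk M S' \<le> card S' + rk M S"
proof -
  have fin: "finite S'" using assms finite_ground finite_subset by blast
  obtain B where B: "B \<in> indeps M" "B \<subseteq> S'" "card B = rk M S'"
    using obtain_rk by metis
  have "card S + card B = card (S \<union> B) + card (S \<inter> B)"
    using fin assms finite_indep B by (intro card_Un_Int) (auto intro: finite_subset)
  moreover have "card (S \<union> B) \<le> card S'"
    using fin assms B by (intro card_mono) auto
  moreover have "card (S \<inter> B) \<le> rk M S"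
    using B indep_mono by (intro card_le_rk) auto
  ultimately show ?thesis using B by simp
qed

text \<open>An independent set smaller than the rank can be extended from a largest one, so
  maximality under inclusion and maximal size coincide.\<close>

lemma bases_eq: "bases M = {B \<in> indeps M. card B = rank M}"
proof (intro equalityI subsetI)
  fix B assume B: "B \<in> bases M"
  then have BI: "B \<in> indeps M" and max: "\<And>X. X \<in> indeps M \<Longrightarrow> B \<subseteq> X \<Longrightarrow> X = B"
    by (auto simp: bases_def)
  obtain Y where Y: "Y \<in> indeps M" "card Y = rk M (ground M)"
    using obtain_rk by metis
  have "card B \<le> card Y"
    using BI Y card_le_rk indep_subset_ground by simp
  then obtain Z where "B \<subseteq> Z" "Z \<in> indeps M" "card Z = card Y"
    using extend_indep BI Y by metis
  then show "B \<in> {B \<in> indeps M. card B = rank M}"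
    using max BI Y rank_eq_rk by auto
next
  fix B assume "B \<in> {B \<in> indeps M. card B = rank M}"
  then have B: "B \<in> indeps M" "card B = rank M" by auto
  have "X = B" if "X \<in> indeps M" "B \<subseteq> X" for X
  proof -
    have "card X \<le> card B"
      using that B rank_eq_rk card_le_rk indep_subset_ground by simp
    then show ?thesis using that finite_indep card_seteq by metis
  qed
  then show "B \<in> bases M" using B by (auto simp: bases_def)
qed

lemma coloopless_iff: "coloopless M \<longleftrightarrow> (\<forall>v\<in>ground M. rk M (ground M - {v}) = rank M)"
proof -
  have "(\<exists>B\<in>bases M. v \<notin> B) \<longleftrightarrow> rk M (ground M - {v}) = rank M" (is "?L \<longleftrightarrow> ?R") for v
  proof
    assume ?L
    then obtain B where B: "B \<in> indeps M" "card B = rank M" "v \<notin> B"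
      by (auto simp: bases_eq)
    then have "rank M \<le> rk M (ground M - {v})"
      using card_le_rk[of B "ground M - {v}"] indep_subset_ground by auto
    then show ?R using rk_mono[of "ground M - {v}" "ground M"] rank_eq_rk by auto
  next
    assume ?R
    then show ?L using obtain_rk[of "ground M - {v}"] unfolding bases_eq
      by (smt (verit) Diff_iff insertI1 mem_Collect_eq subsetD)
  qed
  then show ?thesis by (auto simp: coloopless_def)
qed

section \<open>Minors\<close>

lemma matroid_delete: "matroid (delete M D)"
proof
  show "finite (ground (delete M D))" by (simp add: delete_def finite_ground)
  show "indeps (delete M D) \<subseteq> Pow (ground (delete M D))" by (auto simp: delete_def)
  show "{} \<in> indeps (delete M D)" by (simp add: delete_def empty_indep)
  show "Y \<in> indeps (delete M D)" if "X \<in> indeps (delete M D)" "Y \<subseteq> X" for X Y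
    using that indep_mono by (auto simp: delete_def)
  show "\<exists>y\<in>Y - X. insert y X \<in> indeps (delete M D)"
    if "X \<in> indeps (delete M D)" "Y \<in> indeps (delete M D)" "card X < card Y" for X Y
    using that augment[of X Y] by (auto simp: delete_def)
qed

lemma rk_delete:
  assumes "S \<subseteq> ground M - D"
  shows "rk (delete M D) S = rk M S"
proof -
  have "{X \<in> indeps (delete M D). X \<subseteq> S} = {X \<in> indeps M. X \<subseteq> S}"
    using assms by (auto simp: delete_def)
  then show ?thesis by (simp add: rk_def)
qed

lemma bases_restriction:
  assumes "C \<subseteq> ground M"
  shows "bases (restriction M C) = {B \<in> indeps M. B \<subseteq> C \<and> card B = rk M C}"
proof -
  have C: "ground M - (ground M - C) = C" using assms by auto
  interpret R: matroid "restriction M C"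
    unfolding restriction_def by (rule matroid_delete)
  have "ground (restriction M C) = C" by (simp add: restriction_def delete_def C)
  then have "rank (restriction M C) = rk M C"
    using R.rank_eq_rk rk_delete[of C "ground M - C"] assms by (simp add: restriction_def C)
  then show ?thesis
    unfolding R.bases_eq by (auto simp: restriction_def delete_def C)
qed

text \<open>Extend \<open>B'\<close> from \<open>X \<union> B\<close> to the size of
  \<open>X \<union> B\<close>. Nothing from \<open>C\<close> is added, since \<open>B'\<close> is
  maximal there, so the extension lies in \<open>X \<union> B'\<close> and fills it by
  cardinality.\<close>

lemma indep_union_basis_exchange:
  assumes B: "B \<in> indeps M" "B \<subseteq> C" "card B = rk M C"
    and B': "B' \<in> indeps M" "B' \<subseteq> C" "card B' = rk M C"
    and X: "X \<inter> C = {}" "X \<union> B \<in> indeps M"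
  shows "X \<union> B' \<in> indeps M"
proof -
  have fin: "finite X" "finite B" "finite B'"
    using X B B' finite_indep by (auto dest: finite_indep)
  have card_X: "card (X \<union> B) = card X + card B"
    using B X fin by (intro card_Un_disjoint) auto
  then obtain Z where Z: "B' \<subseteq> Z" "Z \<subseteq> B' \<union> (X \<union> B)" "Z \<in> indeps M" "card Z = card (X \<union> B)"
    using extend_indep[of B' "X \<union> B"] X B B' by auto
  have "Z \<inter> C \<subseteq> B'"
  proof
    fix x assume x: "x \<in> Z \<inter> C"
    then have "insert x B' \<in> indeps M" using Z indep_mono[of Z] by auto
    then show "x \<in> B'" using insert_not_indep[OF B'] x by blast
  qed
  then have "Z \<subseteq> X \<union> B'" using Z B by blast
  moreover have "card (X \<union> B') = card Z"
    using B B' X fin Z card_X by (subst card_Un_disjoint) auto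
  ultimately show ?thesis
    using Z fin card_subset_eq[of "X \<union> B'" Z] by auto
qed

text \<open>By the exchange property, one fixed \<open>B\<close> can replace the existential over
  bases in \<open>contract\<close>.\<close>

lemma indeps_contract:
  assumes "C \<subseteq> ground M" and B: "B \<in> indeps M" "B \<subseteq> C" "card B = rk M C"
  shows "indeps (contract M C) = {X. X \<subseteq> ground M - C \<and> X \<union> B \<in> indeps M}"
proof -
  have "(\<exists>B'\<in>bases (restriction M C). X \<union> B' \<in> indeps M) \<longleftrightarrow> X \<union> B \<in> indeps M"
    if "X \<inter> C = {}" for X
    unfolding bases_restriction[OF assms(1)]
    using B indep_union_basis_exchange that by blast
  then show ?thesis
    unfolding contract_def by (auto simp: disjoint_iff subset_iff)
qed

lemma matroid_contract:
  assumes "C \<subseteq> ground M"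
  shows "matroid (contract M C)"
proof -
  obtain B where B: "B \<in> indeps M" "B \<subseteq> C" "card B = rk M C"
    using obtain_rk by metis
  note ind = indeps_contract[OF assms B]
  show ?thesis
  proof
    show "finite (ground (contract M C))" by (simp add: contract_def finite_ground)
    show "indeps (contract M C) \<subseteq> Pow (ground (contract M C))" by (auto simp: contract_def)
    show "{} \<in> indeps (contract M C)" using B by (simp add: ind)
    show "Y \<in> indeps (contract M C)" if "X \<in> indeps (contract M C)" "Y \<subseteq> X" for X Y
      using that indep_mono[of "X \<union> B" "Y \<union> B"] by (auto simp: ind)
    show "\<exists>y\<in>Y - X. insert y X \<in> indeps (contract M C)"
      if "X \<in> indeps (contract M C)" "Y \<in> indeps (contract M C)" and lt: "card X < card Y" for X Y
    proof -
      have XY: "X \<subseteq> ground M - C" "Y \<subseteq> ground M - C" "X \<union> B \<in> indeps M" "Y \<union> B \<in> indeps M"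
        using that by (auto simp: ind)
      have card_Un: "card (Z \<union> B) = card Z + card B" if "Z \<union> B \<in> indeps M" "Z \<subseteq> ground M - C" for Z
        using that B finite_indep[OF that(1)] by (intro card_Un_disjoint) auto
      obtain y where "y \<in> (Y \<union> B) - (X \<union> B)" "insert y (X \<union> B) \<in> indeps M"
        using augment[of "X \<union> B" "Y \<union> B"] XY card_Un lt by fastforce
      then show ?thesis using XY by (auto simp: ind)
    qed
  qed
qed

text \<open>A basis \<open>B\<close> of \<open>C\<close> extends to a largest independent subset
  \<open>Z\<close> of \<open>S \<union> C\<close>. As \<open>Z\<close> meets \<open>C\<close> only
  in \<open>B\<close>, the set \<open>Z - B\<close> lies in \<open>S\<close> and is a largest
  independent subset of \<open>S\<close> in the contraction.\<close>

lemma rk_contract: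
  assumes C: "C \<subseteq> ground M" and S: "S \<subseteq> ground M - C"
  shows "rk (contract M C) S + rk M C = rk M (S \<union> C)"
proof -
  interpret Q: matroid "contract M C" using matroid_contract C .
  obtain B where B: "B \<in> indeps M" "B \<subseteq> C" "card B = rk M C"
    using obtain_rk by metis
  note ind = indeps_contract[OF C B]
  obtain Y where Y: "Y \<in> indeps M" "Y \<subseteq> S \<union> C" "card Y = rk M (S \<union> C)"
    using obtain_rk by metis
  have "card B \<le> card Y" using B Y rk_mono[of C "S \<union> C"] by auto
  then obtain Z where Z: "B \<subseteq> Z" "Z \<subseteq> B \<union> Y" "Z \<in> indeps M" "card Z = card Y"
    using extend_indep B Y by metis
  have "Z \<inter> C \<subseteq> B"
  proof
    fix x assume x: "x \<in> Z \<inter> C"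
    then have "insert x B \<in> indeps M" using Z indep_mono[of Z] by auto
    then show "x \<in> B" using insert_not_indep[OF B] x by blast
  qed
  then have ZB: "Z - B \<subseteq> S" using Z Y B by blast
  have "rk (contract M C) S = rk M (S \<union> C) - rk M C"
  proof (rule Q.rk_eqI)
    show "Z - B \<in> indeps (contract M C)"
      using ZB S Z by (auto simp: ind Un_absorb2)
    show "Z - B \<subseteq> S" by fact
    show "card (Z - B) = rk M (S \<union> C) - rk M C"
      using Z B Y finite_indep by (simp add: card_Diff_subset)
    fix X assume X: "X \<in> indeps (contract M C)" "X \<subseteq> S"
    then have XB: "X \<union> B \<in> indeps M" by (auto simp: ind)
    have "card (X \<union> B) = card X + card B"
      using X S B finite_indep[OF XB] by (intro card_Un_disjoint) auto
    moreover have "card (X \<union> B) \<le> rk M (S \<union> C)"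
      using XB X B by (intro card_le_rk) auto
    ultimately show "card X \<le> rk M (S \<union> C) - rk M C" using B by simp
  qed
  moreover have "rk M C \<le> rk M (S \<union> C)" by (simp add: rk_mono)
  ultimately show ?thesis by simp
qed

lemma contract_empty: "contract M {} = M"
proof (rule indep_system.equality)
  have "indeps (contract M {}) = {X. X \<subseteq> ground M \<and> X \<in> indeps M}"
    using indeps_contract[of "{}" "{}"] empty_indep rk_indep[of "{}"] by simp
  then show "indeps (contract M {}) = indeps M" using indep_subset_ground by auto
qed (simp_all add: contract_def)

lemma delete_empty: "delete M {} = M"
  using indep_subset_ground by (auto simp: delete_def intro!: indep_system.equality)

end

section \<open>Bad sets\<close>

text \<open>The bound 0 forces the second part to be empty, and the bound \<open>k\<close> on the
  first part is automatic: the model consists of \<open>k\<close> coloops and \<open>l\<close>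
  loops.\<close>

lemma indeps_uniform_plus_loops:
  "X \<in> indeps (direct_sum (uniform_matroid k {..<k}) (uniform_matroid 0 {k..<k + l})) \<longleftrightarrow>
    X \<subseteq> {..<k}"
proof
  assume "X \<in> indeps (direct_sum (uniform_matroid k {..<k}) (uniform_matroid 0 {k..<k + l}))"
  then obtain Y Z where X: "X = Y \<union> Z" "Y \<subseteq> {..<k}" "Z \<subseteq> {k..<k + l}" "card Z = 0"
    by (auto simp: direct_sum_def uniform_matroid_def)
  then have "Z = {}" by (metis card_0_eq finite_atLeastLessThan finite_subset)
  then show "X \<subseteq> {..<k}" using X by simp
next
  assume X: "X \<subseteq> {..<k}"
  then have "card X \<le> k" using card_mono[of "{..<k}" X] by simp
  then show "X \<in> indeps (direct_sum (uniform_matroid k {..<k}) (uniform_matroid 0 {k..<k + l}))"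
    using X by (force simp: direct_sum_def uniform_matroid_def)
qed

text \<open>The corank is \<open>rank M - rk M S\<close> and the nullity
  \<open>card S - rk M S\<close>; sums again avoid subtraction on naturals.\<close>

definition bad :: "nat \<Rightarrow> nat \<Rightarrow> 'a indep_system \<Rightarrow> 'a set \<Rightarrow> bool" where
  "bad k l M S \<longleftrightarrow> S \<subseteq> ground M \<and> rk M S + k \<le> rank M \<and> rk M S + l \<le> card S"

section \<open>Bad sets, minors and almost uniformity\<close>

context matroid
begin

text \<open>Deletion keeps the rank and size of a surviving set and can only lower the total
  rank.\<close>

lemma bad_delete:
  assumes "bad k l (delete M D) S"
  shows "bad k l M S" "S \<inter> D = {}"
proof -
  interpret Q: matroid "delete M D" by (rule matroid_delete)
  have S: "S \<subseteq> ground M - D" using assms by (auto simp: bad_def delete_def)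
  then show "S \<inter> D = {}" by auto
  have "rank (delete M D) \<le> rank M"
    unfolding Q.rank_eq_rk rank_eq_rk using rk_delete rk_mono
    by (simp add: delete_def)
  then show "bad k l M S"
    using assms S rk_delete[OF S] by (auto simp: bad_def)
qed

text \<open>Adding \<open>C\<close> raises the rank of the set by \<open>rk M C\<close>, the amount
  by which the total ranks differ, so the corank is unchanged. The nullity grows by
  \<open>card C - rk M C\<close>, which is not negative.\<close>

lemma bad_contract:
  assumes "C \<subseteq> ground M" "bad k l (contract M C) S"
  shows "bad k l M (S \<union> C)"
proof -
  interpret Q: matroid "contract M C" using matroid_contract assms(1) .
  have S: "S \<subseteq> ground M - C" using assms by (auto simp: bad_def contract_def)
  have fin: "finite S" "finite C" using S assms finite_ground finite_subset by blast+
  have g: "ground (contract M C) = ground M - C" by (simp add: contract_def)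
  have "rank (contract M C) + rk M C = rank M"
    unfolding Q.rank_eq_rk rank_eq_rk g
    using rk_contract[OF assms(1), of "ground M - C"] assms(1) by (simp add: Un_absorb2)
  moreover have "card (S \<union> C) = card S + card C"
    using S fin by (intro card_Un_disjoint) auto
  moreover have "rk M C \<le> card C" using fin rk_le_card by auto
  ultimately show ?thesis
    using assms S rk_contract[OF assms(1) S] by (auto simp: bad_def)
qed

lemma bad_minor:
  assumes "C \<subseteq> ground M" "bad k l (delete (contract M C) D) S"
  shows "bad k l M (S \<union> C)" "S \<inter> D = {}"
  using bad_contract[OF assms(1)] matroid.bad_delete[OF matroid_contract[OF assms(1)] assms(2)]
  by simp_all

text \<open>The loops of the model correspond to a set of rank 0 and size \<open>l\<close>, which is
  bad because the coloops correspond to an independent set of size \<open>k\<close>.\<close>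

lemma bad_of_isomorphic:
  assumes "isomorphic M (direct_sum (uniform_matroid k {..<k}) (uniform_matroid 0 {k..<k + l}))"
  shows "\<exists>S. bad k l M S"
proof -
  let ?U = "direct_sum (uniform_matroid k {..<k}) (uniform_matroid 0 {k..<k + l})"
  obtain f where f: "bij_betw f (ground M) (ground ?U)"
    and ind: "\<And>X. X \<subseteq> ground M \<Longrightarrow> X \<in> indeps M \<longleftrightarrow> f ` X \<in> indeps ?U"
    using assms unfolding isomorphic_def by blast
  have gU: "ground ?U = {..<k + l}" by (auto simp: direct_sum_def uniform_matroid_def)
  note iU = indeps_uniform_plus_loops
  define g where "g = inv_into (ground M) f"
  have g: "bij_betw g {..<k + l} (ground M)"
    using bij_betw_inv_into[OF f] by (simp add: gU g_def)
  have fg: "f ` g ` Y = Y" if "Y \<subseteq> {..<k + l}" for Y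
    using f that unfolding g_def gU by (metis bij_betw_imp_surj_on image_inv_into_cancel)
  have sub: "g ` Y \<subseteq> ground M" if "Y \<subseteq> {..<k + l}" for Y
    using g that bij_betw_imp_surj_on by blast
  have card_g: "card (g ` Y) = card Y" if "Y \<subseteq> {..<k + l}" for Y
    using g that by (meson bij_betw_def card_image inj_on_subset)
  have "g ` {..<k} \<in> indeps M"
    using ind[of "g ` {..<k}"] sub fg iU by simp
  then have "k \<le> rank M"
    using card_le_rk[of "g ` {..<k}" "ground M"] sub[of "{..<k}"] card_g[of "{..<k}"]
    by (simp add: rank_eq_rk)
  moreover have "rk M (g ` {k..<k + l}) = 0"
  proof (rule rk_eqI[OF _ empty_indep])
    fix X assume X: "X \<in> indeps M" "X \<subseteq> g ` {k..<k + l}"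
    then obtain Y where Y: "Y \<subseteq> {k..<k + l}" "X = g ` Y" by (meson subset_imageE)
    have "Y \<subseteq> {..<k + l}" using Y by auto
    then have "Y \<subseteq> {..<k}" using X(1) ind[of X] sub fg iU Y by simp
    then have "Y = {}" using Y by fastforce
    then show "card X \<le> 0" using Y by simp
  qed auto
  ultimately have "bad k l M (g ` {k..<k + l})"
    using sub[of "{k..<k + l}"] card_g[of "{k..<k + l}"]
    by (simp add: bad_def ivl_disj_un subset_eq)
  then show ?thesis by blast
qed

text \<open>Contract a basis \<open>B\<close> of \<open>S\<close> and keep only \<open>L\<close> and
  \<open>K\<close>: the \<open>l\<close> elements \<open>L\<close> of \<open>S - B\<close> become
  loops, and the \<open>k\<close> elements \<open>K\<close>, taken from a basis of \<open>M\<close>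
  that includes \<open>B\<close>, become coloops.\<close>

lemma bad_imp_minor:
  assumes "bad k l M S"
  shows "\<exists>M'. is_minor M' M \<and>
    isomorphic M' (direct_sum (uniform_matroid k {..<k}) (uniform_matroid 0 {k..<k + l}))"
proof -
  have S: "S \<subseteq> ground M" "rk M S + k \<le> rank M" "rk M S + l \<le> card S"
    using assms by (auto simp: bad_def)
  have finS: "finite S" using S finite_ground finite_subset by blast
  obtain B where B: "B \<in> indeps M" "B \<subseteq> S" "card B = rk M S"
    using obtain_rk by metis
  have "l \<le> card (S - B)" using S B finS finite_indep by (simp add: card_Diff_subset)
  then obtain L where L: "L \<subseteq> S - B" "card L = l" "finite L"
    using obtain_subset_with_card_n by metis
  obtain Y where Y: "Y \<in> indeps M" "card Y = rank M"
    using obtain_rk rank_eq_rk by metis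
  then obtain Z where Z: "B \<subseteq> Z" "Z \<in> indeps M" "card Z = rank M"
    using extend_indep[of B Y] B S by (metis add_leD1)
  have "k \<le> card (Z - B)" using Z S B finite_indep by (simp add: card_Diff_subset)
  then obtain K where K: "K \<subseteq> Z - B" "card K = k" "finite K"
    using obtain_subset_with_card_n by metis
  have ins: "insert x B \<notin> indeps M" if "x \<in> S - B" for x
    using insert_not_indep[OF B that] .
  \<comment> \<open>An element of \<open>K\<close> in \<open>S\<close> would enlarge
    \<open>B\<close> to an independent subset of \<open>S\<close>.\<close>
  have KS: "K \<inter> S = {}"
  proof (rule ccontr)
    assume "K \<inter> S \<noteq> {}"
    then obtain x where x: "x \<in> K" "x \<in> S - B" using K by blast
    then have "insert x B \<subseteq> Z" using K Z by blast
    then have "insert x B \<in> indeps M" using Z indep_mono by metis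
    then show False using ins x by blast
  qed
  have Zg: "Z \<subseteq> ground M" using Z indep_subset_ground by blast
  define D where "D = ground M - (B \<union> K \<union> L)"
  define M' where "M' = delete (contract M B) D"
  have BG: "B \<subseteq> ground M" using B indep_subset_ground by blast
  have minor: "is_minor M' M"
    unfolding is_minor_def M'_def using BG
    by (intro exI[of _ B] exI[of _ D]) (auto simp: D_def)
  have gM': "ground M' = K \<union> L"
    using K L S Zg by (auto simp: M'_def D_def delete_def contract_def)
  have "X \<in> indeps M' \<longleftrightarrow> X \<subseteq> K \<union> L \<and> X \<union> B \<in> indeps M" for X
    unfolding M'_def using indeps_contract[OF BG B(1) subset_refl] rk_indep[OF B(1)] gM'
    by (auto simp: delete_def contract_def D_def M'_def)
  \<comment> \<open>An element of \<open>L\<close> is dependent together with \<open>B\<close>, so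
    it cannot occur in \<open>X\<close>; conversely, \<open>K \<union> B\<close> lies in the
    independent set \<open>Z\<close>.\<close>
  moreover have "X \<union> B \<in> indeps M \<longleftrightarrow> X \<subseteq> K" if "X \<subseteq> K \<union> L" for X
  proof
    assume XB: "X \<union> B \<in> indeps M"
    show "X \<subseteq> K"
    proof
      fix x assume "x \<in> X"
      then have "insert x B \<subseteq> X \<union> B" by blast
      then have "insert x B \<in> indeps M" using XB indep_mono by metis
      then show "x \<in> K" using \<open>x \<in> X\<close> that L ins by blast
    qed
  next
    assume "X \<subseteq> K"
    then have "X \<union> B \<subseteq> Z" using K Z by blast
    then show "X \<union> B \<in> indeps M" using Z indep_mono by metis
  qed
  ultimately have iM': "X \<in> indeps M' \<longleftrightarrow> X \<subseteq> K" for X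
    by blast
  let ?U = "direct_sum (uniform_matroid k {..<k}) (uniform_matroid 0 {k..<k + l})"
  have gU: "ground ?U = {..<k} \<union> {k..<k + l}" by (simp add: direct_sum_def uniform_matroid_def)
  note iU = indeps_uniform_plus_loops
  obtain f1 where f1: "bij_betw f1 K {..<k}"
    using K by (metis bij_betw_iff_card card_lessThan finite_lessThan)
  obtain f2 where f2: "bij_betw f2 L {k..<k + l}"
    using L by (metis add_diff_cancel_left' bij_betw_iff_card card_atLeastLessThan finite_atLeastLessThan)
  define f where "f x = (if x \<in> K then f1 x else f2 x)" for x
  have KL: "K \<inter> L = {}" using KS L by blast
  have fK: "bij_betw f K {..<k}" using f1 by (rule bij_betw_cong[THEN iffD2, rotated]) (simp add: f_def)
  have fL: "bij_betw f L {k..<k + l}"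
    using f2 by (rule bij_betw_cong[THEN iffD2, rotated]) (use KL in \<open>auto simp: f_def\<close>)
  have "bij_betw f (ground M') (ground ?U)"
    unfolding gM' gU using fK fL by (rule bij_betw_combine) auto
  moreover have "X \<in> indeps M' \<longleftrightarrow> f ` X \<in> indeps ?U" if "X \<subseteq> ground M'" for X
  proof
    assume "X \<in> indeps M'"
    then have "f ` X \<subseteq> f ` K" using iM' by (intro image_mono) simp
    then show "f ` X \<in> indeps ?U" using iU bij_betw_imp_surj_on[OF fK] by simp
  next
    assume "f ` X \<in> indeps ?U"
    then have fX: "f ` X \<subseteq> {..<k}" by (simp add: iU)
    have "x \<in> K" if "x \<in> X" for x
    proof (rule ccontr)
      assume "x \<notin> K"
      then have "x \<in> L" using that \<open>X \<subseteq> ground M'\<close> gM' by blast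
      then have "f x \<in> {k..<k + l}" using bij_betwE[OF fL] by blast
      then show False using fX that by auto
    qed
    then have "X \<subseteq> K" by blast
    then show "X \<in> indeps M'" using iM' by blast
  qed
  ultimately have "isomorphic M' ?U" unfolding isomorphic_def by blast
  then show ?thesis using minor by blast
qed

text \<open>This turns statements about minors into rank inequalities. For the second direction, the
  bad set of the minor is lifted to \<open>M\<close> by adding the contracted elements.\<close>

lemma kl_uniform_iff: "kl_uniform k l M \<longleftrightarrow> (\<nexists>S. bad k l M S)"
proof
  assume "kl_uniform k l M"
  then show "\<nexists>S. bad k l M S" using bad_imp_minor unfolding kl_uniform_def by blast
next
  assume no_bad: "\<nexists>S. bad k l M S"
  show "kl_uniform k l M"
    unfolding kl_uniform_def
  proof safe
    fix M' assume M': "is_minor M' M"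
      "isomorphic M' (direct_sum (uniform_matroid k {..<k}) (uniform_matroid 0 {k..<k + l}))"
    then obtain C D where CD: "C \<subseteq> ground M" "M' = delete (contract M C) D"
      unfolding is_minor_def by blast
    interpret M': matroid M'
      unfolding CD(2) using matroid.matroid_delete[OF matroid_contract[OF CD(1)]] .
    obtain S where "bad k l M' S" using M'.bad_of_isomorphic[OF M'(2)] by blast
    then have "bad k l M (S \<union> C)" using bad_minor(1)[OF CD(1)] CD(2) by simp
    then show False using no_bad by simp
  qed
qed

lemma matroid_minor: "is_minor M' M \<Longrightarrow> matroid M'"
  unfolding is_minor_def using matroid.matroid_delete[OF matroid_contract] by blast

text \<open>An element \<open>u\<close> at which the minor fails gives two bad sets of
  \<open>M\<close>, one without \<open>u\<close> and one with it, so that both \<open>P\<close> and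
  \<open>Q\<close> arise by lifting from the minor.\<close>

lemma almost_kl_uniform_minor:
  assumes bad: "\<And>S. bad k l M S \<Longrightarrow> S = P \<or> S = Q"
    and PQ: "P \<inter> Q = {}" "P \<union> Q = ground M"
    and M': "is_minor M' M" "M' \<noteq> M"
  shows "almost_kl_uniform k l M'"
proof (rule ccontr)
  assume "\<not> almost_kl_uniform k l M'"
  then obtain u where u: "u \<in> ground M'"
    "\<not> kl_uniform k l (delete M' {u})" "\<not> kl_uniform k l (contract M' {u})"
    unfolding almost_kl_uniform_def by blast
  obtain C D where CD: "C \<subseteq> ground M" "D \<subseteq> ground M" "C \<inter> D = {}" "M' = delete (contract M C) D"
    using M'(1) unfolding is_minor_def by blast
  interpret M': matroid M' using matroid_minor M'(1) .
  have uCD: "u \<notin> C" using u CD by (auto simp: delete_def contract_def)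
  obtain S where S: "bad k l (delete M' {u}) S"
    using u matroid.kl_uniform_iff[OF M'.matroid_delete] by blast
  obtain S' where S': "bad k l (contract M' {u}) S'"
    using u matroid.kl_uniform_iff[OF M'.matroid_contract, of "{u}"] by blast
  have S1: "bad k l M' S" "u \<notin> S" using M'.bad_delete[OF S] by auto
  have S2: "bad k l M' (S' \<union> {u})" using M'.bad_contract[OF _ S'] u by auto
  note b1 = bad_minor[OF CD(1) S1(1)[unfolded CD(4)]]
  note b2 = bad_minor[OF CD(1) S2[unfolded CD(4)]]
  \<comment> \<open>Only the second set contains \<open>u\<close>: it survives in the minor, so it
    is not in \<open>C\<close>.\<close>
  have "(S \<union> C) \<noteq> (S' \<union> {u} \<union> C)" using S1 uCD by auto
  then have "S \<union> C = P \<and> S' \<union> {u} \<union> C = Q \<or> S \<union> C = Q \<and> S' \<union> {u} \<union> C = P"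
    using bad b1 b2 by metis
  \<comment> \<open>\<open>C\<close> lies in both of the disjoint sets \<open>P\<close> and
    \<open>Q\<close>, while \<open>D\<close> avoids both although they cover the ground set.\<close>
  then have "C = {}" "D = {}" using PQ b1(2) b2(2) CD by blast+
  then have "M' = M" using CD(4) contract_empty delete_empty by simp
  then show False using M'(2) by blast
qed

text \<open>Deleting \<open>v\<close>, which is no coloop, keeps the rank, so \<open>P\<close> stays
  bad. Contracting \<open>v\<close>, which is no loop, lowers the total rank, the rank of
  \<open>Q\<close> and the size of \<open>Q\<close> by one each, so \<open>Q - {v}\<close> keeps the
  corank and nullity of \<open>Q\<close>.\<close>

lemma not_almost_kl_uniform:
  assumes ll: "loopless M" and cl: "coloopless M"
    and P: "bad k l M P" "v \<notin> P" and Q: "bad k l M Q" "v \<in> Q"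
  shows "\<not> almost_kl_uniform k l M"
proof -
  have v: "v \<in> ground M" using Q by (auto simp: bad_def)
  interpret D: matroid "delete M {v}" by (rule matroid_delete)
  interpret C: matroid "contract M {v}" using v by (intro matroid_contract) auto
  have P': "P \<subseteq> ground M - {v}" using P by (auto simp: bad_def)
  have "rank (delete M {v}) = rank M"
    unfolding D.rank_eq_rk using cl v rk_delete[of "ground M - {v}" "{v}"]
    by (simp add: coloopless_iff) (simp add: delete_def)
  then have "bad k l (delete M {v}) P"
    using P P' rk_delete[OF P'] by (auto simp: bad_def delete_def)
  then have nd: "\<not> kl_uniform k l (delete M {v})" using D.kl_uniform_iff by blast
  have rv: "rk M {v} = 1" using ll v rk_indep[of "{v}"] by (auto simp: loopless_def)
  have g: "ground (contract M {v}) = ground M - {v}" by (simp add: contract_def)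
  have "rank (contract M {v}) + 1 = rank M"
    unfolding C.rank_eq_rk rank_eq_rk g
    using rk_contract[of "{v}" "ground M - {v}"] v rv by (simp add: insert_absorb)
  moreover have "rk (contract M {v}) (Q - {v}) + 1 = rk M Q"
    using rk_contract[of "{v}" "Q - {v}"] v rv Q by (auto simp: insert_absorb bad_def)
  moreover have "card (Q - {v}) + 1 = card Q"
    using Q finite_ground finite_subset unfolding bad_def
    by (metis Suc_eq_plus1 card_Suc_Diff1)
  ultimately have "bad k l (contract M {v}) (Q - {v})"
    using Q by (auto simp: bad_def g)
  then have "\<not> kl_uniform k l (contract M {v})" using C.kl_uniform_iff by blast
  then show ?thesis using nd v by (auto simp: almost_kl_uniform_def)
qed

end

section \<open>Truncations, uniform matroids and direct sums\<close>

text \<open>A closed form for iterated truncation: with a bound on the size instead of repeated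
  removal of bases, ranks can be computed directly.\<close>

definition truncate_to :: "nat \<Rightarrow> 'a indep_system \<Rightarrow> 'a indep_system" where
  "truncate_to j M = \<lparr>ground = ground M, indeps = {X \<in> indeps M. card X \<le> j}\<rparr>"

context matroid
begin

lemma matroid_truncate_to: "matroid (truncate_to j M)"
proof
  show "finite (ground (truncate_to j M))" by (simp add: truncate_to_def finite_ground)
  show "indeps (truncate_to j M) \<subseteq> Pow (ground (truncate_to j M))"
    using indeps_subset by (auto simp: truncate_to_def)
  show "{} \<in> indeps (truncate_to j M)" by (simp add: truncate_to_def empty_indep)
  show "Y \<in> indeps (truncate_to j M)" if "X \<in> indeps (truncate_to j M)" "Y \<subseteq> X" for X Y
    using that indep_mono[of X Y] card_mono[of X Y] finite_indep[of X]
    by (auto simp: truncate_to_def)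
  show "\<exists>y\<in>Y - X. insert y X \<in> indeps (truncate_to j M)"
    if "X \<in> indeps (truncate_to j M)" "Y \<in> indeps (truncate_to j M)"
      and lt: "card X < card Y" for X Y
  proof -
    have XY: "X \<in> indeps M" "Y \<in> indeps M" "card Y \<le> j" using that by (auto simp: truncate_to_def)
    then obtain y where y: "y \<in> Y - X" "insert y X \<in> indeps M" using augment[of X Y] lt by blast
    moreover have "card (insert y X) \<le> j"
      using y XY lt finite_indep[of X] by simp
    ultimately show ?thesis by (auto simp: truncate_to_def)
  qed
qed

text \<open>A largest independent subset of \<open>S\<close> can be cut down to any smaller size, so
  the rank is merely capped at \<open>j\<close>.\<close>

lemma rk_truncate_to: "rk (truncate_to j M) S = min j (rk M S)"
proof -
  interpret Q: matroid "truncate_to j M" by (rule matroid_truncate_to)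
  obtain B where B: "B \<in> indeps M" "B \<subseteq> S" "card B = rk M S"
    using obtain_rk by metis
  have "min j (rk M S) \<le> card B" using B by simp
  then obtain B' where B': "B' \<subseteq> B" "card B' = min j (rk M S)"
    using obtain_subset_with_card_n by metis
  have "B' \<in> indeps M" using indep_mono[OF B(1) B'(1)] .
  show ?thesis
  proof (rule Q.rk_eqI)
    show "B' \<in> indeps (truncate_to j M)"
      using B'(2) \<open>B' \<in> indeps M\<close> by (simp add: truncate_to_def)
    show "B' \<subseteq> S" using B B' by blast
    show "card X \<le> min j (rk M S)" if "X \<in> indeps (truncate_to j M)" "X \<subseteq> S" for X
      using that card_le_rk[of X S] by (simp add: truncate_to_def)
  qed fact
qed

lemma rank_truncate_to: "rank (truncate_to j M) = min j (rank M)"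
  by (simp add: matroid.rank_eq_rk[OF matroid_truncate_to] rank_eq_rk rk_truncate_to)
    (simp add: truncate_to_def)

text \<open>The bases of the matroid truncated to \<open>rank M - m\<close> are its independent sets
  of exactly that size, so each truncation lowers the bound by one. The premise keeps the rank
  positive before every truncation.\<close>

lemma truncation_power: "m \<le> rank M \<Longrightarrow> (truncation ^^ m) M = truncate_to (rank M - m) M"
proof (induction m)
  case 0
  show ?case using card_le_rk indep_subset_ground
    by (auto simp: truncate_to_def rank_eq_rk intro!: indep_system.equality)
next
  case (Suc m)
  let ?T = "truncate_to (rank M - m) M"
  have "bases ?T = {B \<in> indeps ?T. card B = rank M - m}"
    by (simp add: matroid.bases_eq[OF matroid_truncate_to] rank_truncate_to)
  then have "truncation ?T = truncate_to (rank M - Suc m) M"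
    using Suc.prems unfolding truncation_def
    by (intro indep_system.equality set_eqI) (simp_all add: truncate_to_def, linarith)
  then show ?case using Suc by simp
qed

end

section \<open>Uniform matroids\<close>

lemma matroid_uniform:
  assumes "finite E"
  shows "matroid (uniform_matroid r E)"
proof
  show "finite (ground (uniform_matroid r E))" by (simp add: uniform_matroid_def assms)
  show "indeps (uniform_matroid r E) \<subseteq> Pow (ground (uniform_matroid r E))"
    by (auto simp: uniform_matroid_def)
  show "{} \<in> indeps (uniform_matroid r E)" by (simp add: uniform_matroid_def)
  show "Y \<in> indeps (uniform_matroid r E)" if "X \<in> indeps (uniform_matroid r E)" "Y \<subseteq> X" for X Y
    using that assms
    by (simp add: uniform_matroid_def) (meson card_mono finite_subset order_trans)
  show "\<exists>y\<in>Y - X. insert y X \<in> indeps (uniform_matroid r E)"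
    if "X \<in> indeps (uniform_matroid r E)" "Y \<in> indeps (uniform_matroid r E)"
      and lt: "card X < card Y" for X Y
  proof -
    have XY: "X \<subseteq> E" "Y \<subseteq> E" "card Y \<le> r" using that by (auto simp: uniform_matroid_def)
    then have "finite X" "finite Y" using assms finite_subset by blast+
    moreover from this obtain y where "y \<in> Y - X"
      using lt by (metis DiffI card_mono leD subsetI)
    ultimately show ?thesis
      using lt XY by (intro bexI[of _ y]) (auto simp: uniform_matroid_def)
  qed
qed

lemma rk_uniform:
  assumes "finite E" "S \<subseteq> E"
  shows "rk (uniform_matroid r E) S = min r (card S)"
proof -
  interpret matroid "uniform_matroid r E" using assms(1) by (rule matroid_uniform)
  have "min r (card S) \<le> card S" by simp
  then obtain B where B: "B \<subseteq> S" "card B = min r (card S)"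
    using obtain_subset_with_card_n by metis
  show ?thesis
  proof (rule rk_eqI[OF _ _ B])
    show "B \<in> indeps (uniform_matroid r E)"
      using assms B by (auto simp: uniform_matroid_def)
    show "card X \<le> min r (card S)" if "X \<in> indeps (uniform_matroid r E)" "X \<subseteq> S" for X
      using that card_mono[of S X] finite_subset[OF assms(2,1)] by (simp add: uniform_matroid_def)
  qed
qed

section \<open>Direct sums on disjoint ground sets\<close>

locale disjoint_matroids = A: matroid A + B: matroid B
  for A B :: "'a indep_system" +
  assumes disj: "ground A \<inter> ground B = {}"
begin

text \<open>Disjointness makes the two parts of an independent set unique: they are its traces on
  the summands.\<close>

lemma indeps_direct_sum:
  "X \<in> indeps (direct_sum A B) \<longleftrightarrow>
    X \<subseteq> ground A \<union> ground B \<and> X \<inter> ground A \<in> indeps A \<and> X \<inter> ground B \<in> indeps B"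
proof
  assume "X \<in> indeps (direct_sum A B)"
  then obtain Y Z where X: "X = Y \<union> Z" and YZ: "Y \<in> indeps A" "Z \<in> indeps B"
    by (auto simp: direct_sum_def)
  have sub: "Y \<subseteq> ground A" "Z \<subseteq> ground B"
    using YZ A.indep_subset_ground B.indep_subset_ground by simp_all
  then have "X \<inter> ground A = Y" "X \<inter> ground B = Z"
    using X disj by blast+
  then show "X \<subseteq> ground A \<union> ground B \<and> X \<inter> ground A \<in> indeps A \<and> X \<inter> ground B \<in> indeps B"
    using X YZ sub by auto
next
  assume X: "X \<subseteq> ground A \<union> ground B \<and> X \<inter> ground A \<in> indeps A \<and> X \<inter> ground B \<in> indeps B"
  then have "X = (X \<inter> ground A) \<union> (X \<inter> ground B)" by blast
  moreover have "X \<inter> ground A \<in> indeps A" "X \<inter> ground B \<in> indeps B" using X by simp_all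
  ultimately show "X \<in> indeps (direct_sum A B)"
    unfolding direct_sum_def by (simp only: indep_system.simps) blast
qed

lemma card_split:
  assumes "X \<subseteq> ground A \<union> ground B"
  shows "card X = card (X \<inter> ground A) + card (X \<inter> ground B)"
proof -
  have "card ((X \<inter> ground A) \<union> (X \<inter> ground B)) = card (X \<inter> ground A) + card (X \<inter> ground B)"
    using disj A.finite_ground B.finite_ground by (intro card_Un_disjoint) auto
  moreover have "(X \<inter> ground A) \<union> (X \<inter> ground B) = X" using assms by blast
  ultimately show ?thesis by simp
qed

lemma matroid_direct_sum: "matroid (direct_sum A B)"
proof
  show "finite (ground (direct_sum A B))"
    using A.finite_ground B.finite_ground by (simp add: direct_sum_def)
  show "indeps (direct_sum A B) \<subseteq> Pow (ground (direct_sum A B))"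
    using indeps_direct_sum by (auto simp: direct_sum_def)
  show "{} \<in> indeps (direct_sum A B)"
    using A.empty_indep B.empty_indep by (simp add: indeps_direct_sum)
  show "Y \<in> indeps (direct_sum A B)" if "X \<in> indeps (direct_sum A B)" "Y \<subseteq> X" for X Y
  proof -
    have "Y \<inter> ground A \<subseteq> X \<inter> ground A" "Y \<inter> ground B \<subseteq> X \<inter> ground B" using that by auto
    then show ?thesis
      using that A.indep_mono B.indep_mono unfolding indeps_direct_sum by (metis order_trans)
  qed
  show "\<exists>y\<in>Y - X. insert y X \<in> indeps (direct_sum A B)"
    if X: "X \<in> indeps (direct_sum A B)" and Y: "Y \<in> indeps (direct_sum A B)"
      and lt: "card X < card Y" for X Y
  proof -
    note X' = X[unfolded indeps_direct_sum] and Y' = Y[unfolded indeps_direct_sum]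
    \<comment> \<open>Sizes add over the summands, so \<open>X\<close> has the smaller trace on one
      of them; augmenting there leaves the other trace unchanged.\<close>
    have "card (X \<inter> ground A) < card (Y \<inter> ground A) \<or> card (X \<inter> ground B) < card (Y \<inter> ground B)"
      using lt card_split[of X] card_split[of Y] X' Y' by linarith
    then show ?thesis
    proof
      assume "card (X \<inter> ground A) < card (Y \<inter> ground A)"
      then obtain y where y: "y \<in> Y \<inter> ground A - X \<inter> ground A" "insert y (X \<inter> ground A) \<in> indeps A"
        using A.augment[of "X \<inter> ground A" "Y \<inter> ground A"] X' Y' by blast
      then have "insert y X \<inter> ground A = insert y (X \<inter> ground A)" "insert y X \<inter> ground B = X \<inter> ground B"
        using disj by auto
      then show ?thesis using y X' by (intro bexI[of _ y]) (auto simp: indeps_direct_sum)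
    next
      assume "card (X \<inter> ground B) < card (Y \<inter> ground B)"
      then obtain y where y: "y \<in> Y \<inter> ground B - X \<inter> ground B" "insert y (X \<inter> ground B) \<in> indeps B"
        using B.augment[of "X \<inter> ground B" "Y \<inter> ground B"] X' Y' by blast
      then have "insert y X \<inter> ground B = insert y (X \<inter> ground B)" "insert y X \<inter> ground A = X \<inter> ground A"
        using disj by auto
      then show ?thesis using y X' by (intro bexI[of _ y]) (auto simp: indeps_direct_sum)
    qed
  qed
qed

lemma rk_direct_sum:
  assumes "S \<subseteq> ground A \<union> ground B"
  shows "rk (direct_sum A B) S = rk A (S \<inter> ground A) + rk B (S \<inter> ground B)"
proof -
  interpret D: matroid "direct_sum A B" by (rule matroid_direct_sum)
  obtain X where X: "X \<in> indeps A" "X \<subseteq> S \<inter> ground A" "card X = rk A (S \<inter> ground A)"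
    using A.obtain_rk by metis
  obtain Y where Y: "Y \<in> indeps B" "Y \<subseteq> S \<inter> ground B" "card Y = rk B (S \<inter> ground B)"
    using B.obtain_rk by metis
  show ?thesis
  proof (rule D.rk_eqI)
    show "X \<union> Y \<in> indeps (direct_sum A B)" using X Y by (auto simp: direct_sum_def)
    show "X \<union> Y \<subseteq> S" using X Y by auto
    have "card (X \<union> Y) = card X + card Y"
      using X Y disj A.finite_indep[of X] B.finite_indep[of Y] by (intro card_Un_disjoint) auto
    then show "card (X \<union> Y) = rk A (S \<inter> ground A) + rk B (S \<inter> ground B)" using X Y by simp
    fix Z assume Z: "Z \<in> indeps (direct_sum A B)" "Z \<subseteq> S"
    have "card Z = card (Z \<inter> ground A) + card (Z \<inter> ground B)"
      using Z assms by (intro card_split) blast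
    also have "\<dots> \<le> rk A (S \<inter> ground A) + rk B (S \<inter> ground B)"
      using Z by (intro add_mono A.card_le_rk B.card_le_rk) (auto simp: indeps_direct_sum)
    finally show "card Z \<le> rk A (S \<inter> ground A) + rk B (S \<inter> ground B)" .
  qed
qed

end

section \<open>The truncated sum and its bad sets\<close>

theorem theorem1p4:
  fixes k l m :: nat and N :: "'a indep_system" and F :: "'a set"
  assumes "k > 0" and "l > 0"
    and "matroid N" and "loopless N" and "coloopless N"
    and "rank N = k + m" and "card (ground N) = k + l + m"
    and "finite F" and "card F = k + l + m" and "F \<inter> ground N = {}"
  defines "T \<equiv> (truncation ^^ m) (direct_sum N (uniform_matroid (k + m) F))"
  shows "loopless T \<and> coloopless T \<and> excluded_minor (almost_kl_uniform k l) T"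
proof -
  let ?U = "uniform_matroid (k + m) F"
  let ?E = "ground N"
  interpret N: matroid N by fact
  interpret U: matroid ?U using \<open>finite F\<close> by (rule matroid_uniform)
  have gU: "ground ?U = F" by (simp add: uniform_matroid_def)
  interpret NU: disjoint_matroids N ?U
    by unfold_locales (use \<open>F \<inter> ground N = {}\<close> gU in auto)
  interpret S: matroid "direct_sum N ?U" by (rule NU.matroid_direct_sum)
  have gS: "ground (direct_sum N ?U) = ?E \<union> F" by (simp add: direct_sum_def gU)
  have rkS: "rk (direct_sum N ?U) S = rk N (S \<inter> ?E) + min (k + m) (card (S \<inter> F))"
    if "S \<subseteq> ?E \<union> F" for S
    using NU.rk_direct_sum[of S] that rk_uniform[OF \<open>finite F\<close>, of "S \<inter> F" "k + m"]
    by (simp add: gU)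
  have rkE: "rk N ?E = k + m" using N.rank_eq_rk \<open>rank N = k + m\<close> by simp
  have EF: "(?E \<union> F) \<inter> ?E = ?E" "(?E \<union> F) \<inter> F = F" "F \<inter> ?E = {}" "?E \<inter> F = {}"
    using \<open>F \<inter> ground N = {}\<close> by auto
  have "rank (direct_sum N ?U) = 2 * (k + m)"
    using rkS[of "?E \<union> F"] \<open>card F = k + l + m\<close> unfolding S.rank_eq_rk gS
    by (simp add: EF rkE)
  \<comment> \<open>The bound is \<open>2 * (k + m) - m\<close>.\<close>
  then have T: "T = truncate_to (2 * k + m) (direct_sum N ?U)"
    unfolding T_def using S.truncation_power[of m] by (simp add: algebra_simps)
  interpret T: matroid T unfolding T by (rule S.matroid_truncate_to)
  have gT: "ground T = ?E \<union> F" by (simp add: T truncate_to_def gS)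
  have rankT: "rank T = 2 * k + m"
    using S.rank_truncate_to \<open>rank (direct_sum N ?U) = _\<close> by (simp add: T)
  have rkT: "rk T S = min (2 * k + m) (rk N (S \<inter> ?E) + min (k + m) (card (S \<inter> F)))"
    if "S \<subseteq> ?E \<union> F" for S
    using S.rk_truncate_to rkS[OF that] by (simp add: T)
  have rk0: "rk N {} = 0" using N.rk_indep[OF N.empty_indep] by simp
  have loopless: "loopless T"
    unfolding loopless_def
  proof safe
    fix v assume "v \<in> ground T" "{v} \<notin> indeps T"
    have "{v} \<in> indeps (direct_sum N ?U)"
    proof (cases "v \<in> F")
      case True
      then have "{v} \<inter> ?E = {}" "{v} \<inter> F = {v}" using EF by auto
      then show ?thesis
        using True \<open>k > 0\<close> N.empty_indep
        by (simp add: NU.indeps_direct_sum gU) (simp add: uniform_matroid_def)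
    next
      case False
      then have v: "v \<in> ?E" using \<open>v \<in> ground T\<close> gT by blast
      then have "{v} \<inter> ?E = {v}" "{v} \<inter> F = {}" using False by auto
      then show ?thesis
        using v \<open>loopless N\<close> U.empty_indep
        by (simp add: NU.indeps_direct_sum gU loopless_def)
    qed
    then show False
      using \<open>{v} \<notin> indeps T\<close> \<open>k > 0\<close> by (simp add: T truncate_to_def)
  qed
  have del_N: "rk N (?E - {v}) = k + m" for v
    using \<open>coloopless N\<close> rkE \<open>rank N = k + m\<close> by (cases "v \<in> ?E") (simp_all add: N.coloopless_iff)
  have coloopless: "coloopless T"
    unfolding T.coloopless_iff
  proof
    fix v
    have "(?E \<union> F - {v}) \<inter> ?E = ?E - {v}" "(?E \<union> F - {v}) \<inter> F = F - {v}"
      by auto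
    \<comment> \<open>At most one of the \<open>k + l + m\<close> elements is lost, so
      \<open>l > 0\<close> keeps the rest spanning in the uniform summand.\<close>
    moreover have "card (F - {v}) \<ge> k + m"
      using card_Diff1_le \<open>card F = k + l + m\<close> \<open>l > 0\<close> \<open>finite F\<close>
      by (cases "v \<in> F") (auto simp: card_Diff_singleton)
    ultimately show "rk T (ground T - {v}) = rank T"
      using rkT[of "?E \<union> F - {v}"] del_N unfolding gT rankT by auto
  qed
  \<comment> \<open>Both inequalities are tight here and for \<open>F\<close>: the rank
    \<open>k + m\<close> is \<open>k\<close> below the total rank and \<open>l\<close> below the
    size.\<close>
  have badE: "bad k l T ?E"
    using rkT[of ?E] rkE \<open>card (ground N) = k + l + m\<close> by (auto simp: bad_def gT rankT EF)
  have badF: "bad k l T F"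
    using rkT[of F] \<open>card F = k + l + m\<close> by (auto simp: bad_def gT rankT EF rk0)
  have only_bad: "S = ?E \<or> S = F" if "bad k l T S" for S
  proof -
    have S: "S \<subseteq> ?E \<union> F" using that by (auto simp: bad_def gT)
    let ?A = "S \<inter> ?E" and ?B = "S \<inter> F"
    have cardS: "card S = card ?A + card ?B" using NU.card_split S by (simp add: gU)
    \<comment> \<open>A bad set has rank at most \<open>k + m\<close>, which is below the cap
      \<open>2 * k + m\<close> as \<open>k > 0\<close>; so its rank is the one in the untruncated
      sum.\<close>
    have low: "rk N ?A + min (k + m) (card ?B) \<le> k + m"
      and null: "rk N ?A + min (k + m) (card ?B) + l \<le> card ?A + card ?B"
      using that rkT[OF S] \<open>k > 0\<close> cardS unfolding bad_def rankT by (auto simp: min_def split: if_splits)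
    show ?thesis
    \<comment> \<open>In the first case \<open>?B\<close> is independent in the uniform summand, so
      \<open>?A\<close> alone must supply the nullity \<open>l\<close>; in the second case
      \<open>?B\<close> spans that summand.\<close>
    proof (cases "card ?B < k + m")
      case True
      have "?A = ?E"
      proof (rule ccontr)
        assume "?A \<noteq> ?E"
        then obtain v where v: "v \<in> ?E" "?A \<subseteq> ?E - {v}" by blast
        \<comment> \<open>Since \<open>N\<close> has no coloops, removing \<open>v\<close> from
          \<open>?E\<close> keeps the rank \<open>k + m\<close> and drops the nullity from
          \<open>l\<close> to \<open>l - 1\<close>, too little for a subset to reach
          \<open>l\<close>.\<close>
        have "card ?A + (k + m) \<le> card (?E - {v}) + rk N ?A"
          using N.nullity_mono[OF v(2)] del_N by simp
        moreover have "card (?E - {v}) < k + l + m"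
          using v N.finite_ground \<open>card (ground N) = k + l + m\<close> card_Diff1_less by metis
        ultimately show False using null True by simp
      qed
      then have "card ?B = 0" using low rkE True by simp
      then have "?B = {}" using \<open>finite F\<close> by simp
      then show ?thesis using \<open>?A = ?E\<close> S by blast
    next
      case False
      \<comment> \<open>The rank \<open>k + m\<close> of \<open>?B\<close> exhausts the bound in
        \<open>low\<close>. Without loops in \<open>N\<close>, a subset of \<open>?E\<close> of rank
        0 is empty, so \<open>?B\<close> alone must supply the nullity and is all of
        \<open>F\<close>.\<close>
      then have "rk N ?A = 0" using low by simp
      have "?A = {}"
      proof (rule ccontr)
        assume "?A \<noteq> {}"
        then obtain v where "v \<in> ?A" by blast
        then have "{v} \<in> indeps N" using \<open>loopless N\<close> by (auto simp: loopless_def)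
        then show False using N.card_le_rk[of "{v}" ?A] \<open>v \<in> ?A\<close> \<open>rk N ?A = 0\<close> by auto
      qed
      then have "k + m + l \<le> card ?B" using null False \<open>rk N ?A = 0\<close> by simp
      then have "?B = F"
        using card_seteq[of F ?B] \<open>finite F\<close> \<open>card F = k + l + m\<close> by auto
      then show ?thesis using \<open>?A = {}\<close> S by blast
    qed
  qed
  have "F \<noteq> {}" using \<open>card F = k + l + m\<close> \<open>k > 0\<close> by auto
  then obtain v where v: "v \<in> F" "v \<notin> ?E" using EF by blast
  \<comment> \<open>Deleting \<open>v\<close> leaves \<open>?E\<close> bad, and contracting it
    leaves \<open>F - {v}\<close> bad.\<close>
  have "\<not> almost_kl_uniform k l T"
    using T.not_almost_kl_uniform[OF loopless coloopless badE v(2) badF v(1)] .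
  moreover have "almost_kl_uniform k l M'" if "is_minor M' T" "M' \<noteq> T" for M'
    using T.almost_kl_uniform_minor[OF only_bad EF(4) gT[symmetric] that] by blast
  ultimately show ?thesis
    using loopless coloopless T.matroid_axioms unfolding excluded_minor_def by blast
qed

end
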